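(* Let $H=(V,E,w,\{r_e\})$ be a hypergraph with maximum hyperedge size $k$, weights $w(e)\ge0$, and monotone nondecreasing rewards $r_e\colon\{0,\dots,|e|\}\to\mathbb{R}_{\ge0}$ with $r_e(0)=0$. For each $e$, let $\hat r_e\colon\{0,\dots,|e|\}\to\mathbb{R}_{\ge 0}$ be an optimal projection of $r_e$, i.e. a monotone nondecreasing convex function with $\hat r_e\le r_e$ pointwise that maximizes the largest $\kappa$ such that $\kappa\, r_e(i)\le\hat r_e(i)$ for all $i\in\{0,\dots,|e|\}$. Let $\beta\in(0,1]$. If a nonempty $S\subseteq V$ satisfies $\hat\Gamma(S)\ge\beta\max_{\emptyset\ne T\subseteq V}\hat\Gamma(T)$, then $\Gamma(S)\ge\frac{\beta}{k}\max_{\emptyset\ne T\subseteq V}\Gamma(T)$.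
   Context: $\Gamma(S)=\frac{1}{|S|}\sum_{e\in E}w(e)\,r_e(|e\cap S|)$ and $\hat\Gamma(S)=\frac{1}{|S|}\sum_{e\in E}w(e)\,\hat r_e(|e\cap S|)$ for nonempty $S\subseteq V$. A function $g\colon\{0,\dots,m\}\to\mathbb{R}$ is convex if $g(i+1)-g(i)\ge g(i)-g(i-1)$ for $i=1,\dots,m-1$. *)

theory Defs
  imports Complex_Main "HOL-Library.Extended_Real"
begin

text \<open>A function on \<open>{0,...,m}\<close> is encoded as \<open>nat \<Rightarrow> real\<close>; only its values
  on \<open>{0..m}\<close> are ever constrained or used.\<close>

definition nonneg_on :: "nat \<Rightarrow> (nat \<Rightarrow> real) \<Rightarrow> bool" where
  "nonneg_on m g \<longleftrightarrow> (\<forall>i\<in>{0..m}. 0 \<le> g i)"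

definition disc_convex :: "nat \<Rightarrow> (nat \<Rightarrow> real) \<Rightarrow> bool" where
  "disc_convex m g \<longleftrightarrow> (\<forall>i\<in>{1..<m}. g (i + 1) - g i \<ge> g i - g (i - 1))"

definition reward :: "nat \<Rightarrow> (nat \<Rightarrow> real) \<Rightarrow> bool" where
  "reward m r \<longleftrightarrow> nonneg_on m r \<and> mono_on {0..m} r \<and> r 0 = 0"

definition reward_hypergraph ::
    "'v set \<Rightarrow> 'v set set \<Rightarrow> ('v set \<Rightarrow> real) \<Rightarrow> ('v set \<Rightarrow> nat \<Rightarrow> real) \<Rightarrow> bool" where
  "reward_hypergraph V E w r \<longleftrightarrow>
     finite V \<and> E \<subseteq> Pow V \<and> (\<forall>e\<in>E. w e \<ge> 0) \<and> (\<forall>e\<in>E. reward (card e) (r e))"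

definition density ::
    "'v set set \<Rightarrow> ('v set \<Rightarrow> real) \<Rightarrow> ('v set \<Rightarrow> nat \<Rightarrow> real) \<Rightarrow> 'v set \<Rightarrow> real" where
  "density E w r S = 1 / real (card S) * (\<Sum>e\<in>E. w e * r e (card (e \<inter> S)))"

definition convex_projection :: "nat \<Rightarrow> (nat \<Rightarrow> real) \<Rightarrow> (nat \<Rightarrow> real) \<Rightarrow> bool" where
  "convex_projection m r g \<longleftrightarrow>
     nonneg_on m g \<and> mono_on {0..m} g \<and> disc_convex m g \<and> (\<forall>i\<in>{0..m}. g i \<le> r i)"

text \<open>The largest \<open>\<kappa>\<close> with \<open>\<kappa> r \<le> g\<close> on \<open>{0..m}\<close>. If \<open>r\<close> is nonnegative and not identically
  zero on \<open>{0..m}\<close>, and \<open>g\<close> is nonnegative, this supremum is finite and attained; if \<open>r\<close>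
  vanishes on \<open>{0..m}\<close>, every \<open>\<kappa>\<close> is admissible and the value is \<open>\<infinity>\<close>.\<close>

definition projection_ratio :: "nat \<Rightarrow> (nat \<Rightarrow> real) \<Rightarrow> (nat \<Rightarrow> real) \<Rightarrow> ereal" where
  "projection_ratio m r g = Sup {ereal \<kappa> | \<kappa>. \<forall>i\<in>{0..m}. \<kappa> * r i \<le> g i}"

definition optimal_projection :: "nat \<Rightarrow> (nat \<Rightarrow> real) \<Rightarrow> (nat \<Rightarrow> real) \<Rightarrow> bool" where
  "optimal_projection m r g \<longleftrightarrow>
     convex_projection m r g \<and>
     (\<forall>h. convex_projection m r h \<longrightarrow> projection_ratio m r h \<le> projection_ratio m r g)"

end

theory Submission
  imports Defs
begin

text \<open>The averaged partial sums \<open>g i = (r 1 + \<dots> + r i) / m\<close> of a reward \<open>r\<close> on \<open>{0..m}\<close> have the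
  nondecreasing increments \<open>r i / m\<close>, so \<open>g\<close> is convex; monotonicity of \<open>r\<close> gives
  \<open>r i / m \<le> g i \<le> r i\<close>. Hence an optimal projection has ratio at least \<open>1 / m\<close>, and the two
  densities differ by a factor between \<open>1 / k\<close> and \<open>1\<close>.\<close>

definition averaged_reward :: "nat \<Rightarrow> (nat \<Rightarrow> real) \<Rightarrow> nat \<Rightarrow> real" where
  "averaged_reward m r i = (\<Sum>j=1..i. r j) / real m"

lemma averaged_reward_Suc:
  "averaged_reward m r (Suc i) = averaged_reward m r i + r (Suc i) / real m"
  by (simp add: averaged_reward_def add_divide_distrib)

lemma reward_nonneg: "reward m r \<Longrightarrow> i \<le> m \<Longrightarrow> 0 \<le> r i"
  by (simp add: reward_def nonneg_on_def)

lemma reward_mono: "reward m r \<Longrightarrow> i \<le> j \<Longrightarrow> j \<le> m \<Longrightarrow> r i \<le> r j"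
  by (auto simp: reward_def intro: mono_onD)

lemma averaged_reward_nonneg:
  assumes "reward m r" "i \<le> m"
  shows "0 \<le> averaged_reward m r i"
  unfolding averaged_reward_def
  using assms by (intro divide_nonneg_nonneg sum_nonneg) (auto intro: reward_nonneg)

text \<open>The numerator contains the summand \<open>r i\<close>, and its other summands are
  nonnegative; for \<open>i = 0\<close> both sides vanish. This makes \<open>1 / real m\<close> an
  admissible factor for the averaged reward.\<close>

lemma averaged_reward_ge:
  assumes r: "reward m r" and i: "i \<le> m"
  shows "r i / real m \<le> averaged_reward m r i"
proof (cases i)
  case 0
  then show ?thesis using r by (simp add: reward_def averaged_reward_def)
next
  case (Suc j)
  then show ?thesis
    using averaged_reward_nonneg[OF r, of j] i by (simp add: averaged_reward_Suc)
qed

lemma convex_projection_averaged_reward: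
  assumes r: "reward m r"
  shows "convex_projection m r (averaged_reward m r)"
proof -
  have "mono_on {0..m} (averaged_reward m r)"
  proof (rule mono_onI)
    fix i j assume "i \<in> {0..m}" "j \<in> {0..m}" "i \<le> j"
    then show "averaged_reward m r i \<le> averaged_reward m r j"
      unfolding averaged_reward_def using r
      by (intro divide_right_mono sum_mono2) (auto intro: reward_nonneg)
  qed
  moreover have "disc_convex m (averaged_reward m r)"
    unfolding disc_convex_def
  proof
    fix i assume i: "i \<in> {1..<m}"
    \<comment> \<open>As \<open>i\<close> is positive, it has a predecessor, so both differences
      unfold to increments, \<open>r i / real m\<close> and
      \<open>r (Suc i) / real m\<close>.\<close>
    then obtain j where j: "i = Suc j" by (cases i) auto
    have "r i / real m \<le> r (Suc i) / real m"
      using reward_mono[OF r, of i "Suc i"] i by (auto intro: divide_right_mono)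
    then show "averaged_reward m r (i + 1) - averaged_reward m r i
        \<ge> averaged_reward m r i - averaged_reward m r (i - 1)"
      by (simp add: j averaged_reward_Suc)
  qed
  moreover have "averaged_reward m r i \<le> r i" if i: "i \<le> m" for i
  proof (cases "m = 0")
    case True
    then show ?thesis using r i by (simp add: averaged_reward_def reward_def)
  next
    case False
    \<comment> \<open>By monotonicity the last summand is the largest, and there are
      \<open>i\<close>, hence at most \<open>m\<close>, of them.\<close>
    have "(\<Sum>j=1..i. r j) \<le> real (card {1..i}) * r i"
      by (rule sum_bounded_above) (use i in \<open>auto intro: reward_mono[OF r]\<close>)
    also have "\<dots> \<le> real m * r i"
      using i reward_nonneg[OF r i] by (auto intro: mult_right_mono)
    finally show ?thesis
      using False by (simp add: averaged_reward_def field_simps)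
  qed
  ultimately show ?thesis
    using averaged_reward_nonneg[OF r] by (auto simp: convex_projection_def nonneg_on_def)
qed

text \<open>The supremum bound descends to each point: where \<open>r i\<close> is positive, every
  admissible factor is at most \<open>g i / r i\<close>, hence so is their supremum; where
  \<open>r i = 0\<close>, only nonnegativity of \<open>g i\<close> is claimed. An infinite ratio
  thus needs no separate treatment.\<close>

lemma le_projection_ratioD:
  assumes "ereal c \<le> projection_ratio m r g" and "0 \<le> r i" and "0 \<le> g i" and "i \<le> m"
  shows "c * r i \<le> g i"
proof (cases "r i = 0")
  case True
  then show ?thesis using assms(3) by simp
next
  case False
  then have pos: "0 < r i" using assms(2) by simp
  have "projection_ratio m r g \<le> ereal (g i / r i)"
    unfolding projection_ratio_def
    by (rule Sup_least) (use pos assms(4) in \<open>auto simp: pos_le_divide_eq\<close>)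
  then have "c \<le> g i / r i" using assms(1) by (meson ereal_less_eq(3) order_trans)
  then show ?thesis using pos by (simp add: pos_le_divide_eq)
qed

text \<open>Optimality transfers the factor \<open>1 / real m\<close> from the averaged reward to
  \<open>g\<close>. Weakening it to \<open>1 / real k\<close> gives one factor common to all
  hyperedges, which can then be pulled out of the density.\<close>

lemma optimal_projection_ge:
  assumes opt: "optimal_projection m r g" and r: "reward m r" and i: "i \<le> m" and "m \<le> k"
  shows "r i / real k \<le> g i"
proof (cases "m = 0")
  \<comment> \<open>Here \<open>i = 0\<close>, so the left-hand side is 0.\<close>
  case True
  then show ?thesis
    using opt r i by (simp add: optimal_projection_def convex_projection_def nonneg_on_def reward_def)
next
  case False
  have g: "0 \<le> g i"
    using opt i by (simp add: optimal_projection_def convex_projection_def nonneg_on_def)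
  have "ereal (1 / real m) \<le> projection_ratio m r (averaged_reward m r)"
    unfolding projection_ratio_def
    by (rule Sup_upper) (use averaged_reward_ge[OF r] in auto)
  also have "\<dots> \<le> projection_ratio m r g"
    using opt convex_projection_averaged_reward[OF r] by (simp add: optimal_projection_def)
  finally have "1 / real m * r i \<le> g i"
    using reward_nonneg[OF r i] g i by (rule le_projection_ratioD)
  moreover have "r i / real k \<le> r i / real m"
    using False \<open>m \<le> k\<close> reward_nonneg[OF r i] by (intro divide_left_mono) auto
  ultimately show ?thesis by simp
qed

lemma density_mono:
  assumes "\<And>e. e \<in> E \<Longrightarrow> 0 \<le> w e"
    and "\<And>e. e \<in> E \<Longrightarrow> r e (card (e \<inter> T)) \<le> s e (card (e \<inter> T))"
  shows "density E w r T \<le> density E w s T"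
  unfolding density_def using assms by (intro mult_left_mono sum_mono) auto

lemma density_divide: "density E w (\<lambda>e i. r e i / c) T = density E w r T / c"
  by (simp add: density_def sum_divide_distrib mult.commute)

theorem theorem6:
  fixes V :: "'v set" and E :: "'v set set" and w :: "'v set \<Rightarrow> real"
    and r rhat :: "'v set \<Rightarrow> nat \<Rightarrow> real" and k :: nat and \<beta> :: real and S :: "'v set"
  assumes "reward_hypergraph V E w r"
    and "k = Max (card ` E)"
    and "\<And>e. e \<in> E \<Longrightarrow> optimal_projection (card e) (r e) (rhat e)"
    and "0 < \<beta>" and "\<beta> \<le> 1"
    and "S \<noteq> {}" and "S \<subseteq> V"
    and "density E w rhat S \<ge> \<beta> * Max (density E w rhat ` {T. T \<noteq> {} \<and> T \<subseteq> V})"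
  shows "density E w r S \<ge> \<beta> / real k * Max (density E w r ` {T. T \<noteq> {} \<and> T \<subseteq> V})"
proof -
  let ?TT = "{T. T \<noteq> {} \<and> T \<subseteq> V}"
  have V: "finite V" and E: "E \<subseteq> Pow V" and w: "\<And>e. e \<in> E \<Longrightarrow> 0 \<le> w e"
    and r: "\<And>e. e \<in> E \<Longrightarrow> reward (card e) (r e)"
    using assms(1) by (auto simp: reward_hypergraph_def)
  have finE: "finite E" using V E by (meson finite_Pow_iff finite_subset)
  have fin: "finite ?TT" using V by simp
  have ne: "?TT \<noteq> {}" using assms(6,7) by blast
  have le_card: "card (e \<inter> T) \<le> card e" if "e \<in> E" for e T
    using that E V by (intro card_mono) (auto intro: finite_subset)
  have "Max (density E w r ` ?TT) \<in> density E w r ` ?TT"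
    using fin ne by (intro Max_in) auto
  then obtain T where T: "T \<in> ?TT" and max: "Max (density E w r ` ?TT) = density E w r T"
    by blast
  \<comment> \<open>\<open>T\<close> maximizes the original density and need not maximize the
    projected one; it only supplies a lower bound for the projected maximum.\<close>
  have "density E w r T / real k = density E w (\<lambda>e i. r e i / real k) T"
    by (rule density_divide[symmetric])
  also have "\<dots> \<le> density E w rhat T"
  proof (rule density_mono[OF w])
    fix e assume e: "e \<in> E"
    have "card e \<le> k" using e finE assms(2) by simp
    then show "r e (card (e \<inter> T)) / real k \<le> rhat e (card (e \<inter> T))"
      using optimal_projection_ge assms(3) r le_card e by blast
  qed
  also have "\<dots> \<le> Max (density E w rhat ` ?TT)"
    using fin T by (intro Max_ge) auto
  finally have "\<beta> * (density E w r T / real k) \<le> \<beta> * Max (density E w rhat ` ?TT)"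
    using assms(4) by (intro mult_left_mono) auto
  also have "\<dots> \<le> density E w rhat S" by (rule assms(8))
  \<comment> \<open>Since \<open>rhat e\<close> lies below \<open>r e\<close>, returning to the
    original rewards at \<open>S\<close> costs nothing; the factor \<open>1 / real k\<close> is lost
    only at \<open>T\<close>.\<close>
  also have "\<dots> \<le> density E w r S"
    using assms(3) le_card
    by (intro density_mono w) (auto simp: optimal_projection_def convex_projection_def)
  finally show ?thesis by (simp add: max)
qed

end
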